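(* Let $P(k) = 112k^3-8k^2-6k+1$. Then $$\sum_{k=1}^\infty \frac{(-1)^{k-1} \binom{2k}{k}^2 \big( P(k) H_{2k-1} + 20k^2(6k-1)/(2k-1) \big)}{(2k-1)^3 k^2 \binom{3k}{k} \binom{6k}{3k}} = 11 \zeta(3)$$ and $$\sum_{k=1}^\infty \frac{(-1)^{k-1} \binom{2k}{k}^2 \big( P(k) (2 H_{6k-1}-H_{3k-1}+H_{k-1}) + 8k^2 \frac{86k-11}{2k-1} \big)}{(2k-1)^3 k^2 \binom{3k}{k} \binom{6k}{3k}} = 50 \zeta(3).$$
   Context: For $n\in\{0,1,2,\ldots\}$, $H_n=\sum_{0<j\le n}\frac1j$ denotes the usual harmonic number (so $H_0=0$). $\zeta$ is the Riemann zeta function. *)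

theory Defs
  imports "HOL-Analysis.Analysis"
begin

text \<open>The Riemann zeta function, given by its Dirichlet series. At arguments where the series
  diverges (real part at most 1) the value is unspecified; no analytic continuation is made.\<close>

definition zeta :: "'a::{real_normed_field, ln} \<Rightarrow> 'a"
  where "zeta s = (\<Sum>n. 1 / of_nat (Suc n) powr s)"

definition P :: "real \<Rightarrow> real"
  where "P x = 112 * x ^ 3 - 8 * x ^ 2 - 6 * x + 1"

text \<open>The two summands, meant for \<open>k \<ge> 1\<close>; for such \<open>k\<close> no subtraction of natural numbers
  is truncated and no denominator vanishes.\<close>

definition term1 :: "nat \<Rightarrow> real"
  where "term1 k =
    (- 1) ^ (k - 1) * real ((2 * k) choose k) ^ 2 *
      (P (real k) * harm (2 * k - 1)
        + 20 * real k ^ 2 * (6 * real k - 1) / (2 * real k - 1))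
    / ((2 * real k - 1) ^ 3 * real k ^ 2
        * real ((3 * k) choose k) * real ((6 * k) choose (3 * k)))"

definition term2 :: "nat \<Rightarrow> real"
  where "term2 k =
    (- 1) ^ (k - 1) * real ((2 * k) choose k) ^ 2 *
      (P (real k) * (2 * harm (6 * k - 1) - harm (3 * k - 1) + harm (k - 1))
        + 8 * real k ^ 2 * ((86 * real k - 11) / (2 * real k - 1)))
    / ((2 * real k - 1) ^ 3 * real k ^ 2
        * real ((3 * k) choose k) * real ((6 * k) choose (3 * k)))"

end

theory Submission imports Defs begin

text \<open>
  Both identities are derivatives of one Wilf--Zeilberger (WZ) summation. With
  \<open>H\<close> for harmonic numbers and \<open>O m\<close> for the sum of \<open>1 / (i + 1/2)\<close> over \<open>i < m\<close>, consider for real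
  \<open>\<epsilon>\<close> the function
    \<open>F\<^sub>\<epsilon>(n,k) = (-1)\<^sup>n (n+k+1) (k! (2n)! / (2n+k+1)!)\<^sup>3
        \<Gamma>(n+k+3/2+\<epsilon>) / \<Gamma>(n+k+3/2-\<epsilon>) \<Gamma>(n+1/2-\<epsilon>)\<^sup>3 / \<Gamma>(3n+1/2-\<epsilon>)\<close>,
  which arises from the general term of Dougall's very well-poised bilateral sum with parameters
  \<open>a = 2n+2\<close>, \<open>b = n+3/2+\<epsilon>\<close>, \<open>c = d = e = 1\<close> by normalising with the gamma factors of Dougall's evaluation.
  There is a rational multiple \<open>G\<^sub>\<epsilon>\<close> of it with \<open>F(n+1,k) - F(n,k) = G(n,k+1) - G(n,k)\<close>, and the
  equation persists when \<open>n\<close> and \<open>k\<close> run through shifted copies of the natural numbers. Summing it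
  over all \<open>n, k \<ge> 0\<close> gives that the sum of \<open>F(0,k)\<close> over \<open>k\<close> equals the sum of
  \<open>G(n,0)\<close> over \<open>n\<close>. Take \<open>\<epsilon> = 0\<close> and normalise by a constant factor so that \<open>F(0,k) = 1/(k+1)\<^sup>2\<close>.
  Then \<open>G(n,0)\<close> is a quarter of the summand of the theorem at \<open>k = n+1\<close>, with the polynomial \<open>P k\<close> in
  place of the large bracket.

  Differentiating the pair in a direction of \<open>(n,k,\<epsilon>)\<close>-space gives again a WZ pair, in which the
  logarithmic derivative of the gamma factors appears as a harmonic weight and the derivative of
  the certificate as a rational correction. Up to additive constants in the weight, which are
  irrelevant because the unweighted pair satisfies the same equation, the direction
  \<open>(5/24, -1/3, 5/8)\<close> turns \<open>G(n,0)\<close> into a quarter of the first summand of the theorem. The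
  direction \<open>(0, 0, 1)\<close> turns it into a quarter of the second summand minus twice the first. The derivation stays heuristic: below, the two weighted pairs are
  written down explicitly and the WZ equations are verified as rational identities
  (\<open>cert_identity\<close>, \<open>cert1_identity\<close>, \<open>cert2_identity\<close>).

  On the other side remain sums over \<open>k\<close> at \<open>n = 0\<close>. They are combinations of \<open>\<zeta>(3)\<close> and of the
  Euler sums of \<open>H m / m\<^sup>2\<close> and \<open>O m / m\<^sup>2\<close> over \<open>m \<ge> 1\<close>, which are \<open>2 \<zeta>(3)\<close> and \<open>7/2 \<zeta>(3)\<close>; both follow from
  the single rearrangement \<open>hsum_pairs\<close>.
\<close>

section \<open>Summation by a Wilf--Zeilberger pair\<close>

text \<open>
  Since \<open>G n\<close> vanishes at infinity, summing the WZ equation over \<open>k\<close> shows that passing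
  from \<open>n\<close> to \<open>n+1\<close> lowers the sum of \<open>F n\<close> by \<open>G n 0\<close>. As \<open>F n\<close> is dominated by a summable function times a null sequence, the sums of \<open>F n\<close>
  tend to \<open>0\<close>, and nothing but the boundary terms \<open>G n 0\<close> is left of the sum of \<open>F 0\<close>.
\<close>

lemma wz_sums:
  fixes F G :: "nat \<Rightarrow> nat \<Rightarrow> real"
  assumes wz: "\<And>n k. F (Suc n) k - F n k = G n (Suc k) - G n k"
    and G: "\<And>n. G n \<longlonglongrightarrow> 0"
    and F: "\<And>n k. \<bar>F (Suc n) k\<bar> \<le> c n * b k" and b: "summable b" and c: "c \<longlonglongrightarrow> 0"
    and F0: "F 0 sums L"
  shows "(\<lambda>n. G n 0) sums L"
proof -
  have S: "F n sums (L - (\<Sum>m<n. G m 0))" for n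
  proof (induction n)
    case (Suc n)
    have "(\<lambda>k. G n (Suc k) - G n k) sums (0 - G n 0)" by (rule telescope_sums[OF G])
    from sums_add[OF Suc this] have "(\<lambda>k. F n k + (G n (Suc k) - G n k)) sums (L - (\<Sum>m<n. G m 0) + (0 - G n 0))" .
    moreover have "(\<lambda>k. F n k + (G n (Suc k) - G n k)) = F (Suc n)"
    proof (rule ext)
      fix k show "F n k + (G n (Suc k) - G n k) = F (Suc n) k" using wz[of n k] by linarith
    qed
    moreover have "L - (\<Sum>m<n. G m 0) + (0 - G n 0) = L - (\<Sum>m<Suc n. G m 0)" by simp
    ultimately show ?case by (simp only:)
  qed (use F0 in simp)
  have "\<bar>L - (\<Sum>m<Suc n. G m 0)\<bar> \<le> c n * suminf b" for n
  proof -
    have sb: "summable (\<lambda>k. c n * b k)" by (intro summable_mult b)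
    have "norm (\<bar>F (Suc n) k\<bar>) \<le> c n * b k" for k using F[of n k] by simp
    hence sF: "summable (\<lambda>k. \<bar>F (Suc n) k\<bar>)"
      by (rule summable_comparison_test'[OF sb])
    have "\<bar>suminf (F (Suc n))\<bar> \<le> (\<Sum>k. \<bar>F (Suc n) k\<bar>)" by (rule summable_rabs[OF sF])
    also have "\<dots> \<le> (\<Sum>k. c n * b k)" by (intro suminf_le F sF sb)
    also have "\<dots> = c n * suminf b" by (rule suminf_mult[OF b])
    finally show ?thesis unfolding sums_unique[OF S[of "Suc n"], symmetric] .
  qed
  hence "(\<lambda>n. L - (\<Sum>m<Suc n. G m 0)) \<longlonglongrightarrow> 0"
    by (intro Lim_null_comparison[OF _ tendsto_mult_left_zero[OF c, of "suminf b"]] always_eventually allI)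
       (simp only: real_norm_def)
  from tendsto_diff[OF tendsto_const[of L] this]
  have "(\<lambda>n. \<Sum>m<Suc n. G m 0) \<longlonglongrightarrow> L" by (simp only: diff_diff_eq2 add_diff_cancel_left' diff_0_right)
  thus ?thesis unfolding sums_def by (rule LIMSEQ_imp_Suc)
qed

section \<open>Two Euler sums\<close>

text \<open>
  For \<open>c = 1\<close> these are the harmonic numbers; for \<open>c = 1/2\<close> they are the sums of reciprocals of
  half-odd numbers that come from the gamma factors at half-integers.
\<close>

definition hsum :: "real \<Rightarrow> nat \<Rightarrow> real" where
  "hsum c m = (\<Sum>i<m. 1 / (real i + c))"

lemma hsum_Suc: "hsum c (Suc m) = hsum c m + 1 / (real m + c)"
  by (simp add: hsum_def)

lemma hsum_1: "hsum 1 m = harm m"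
  by (induction m) (auto simp: hsum_def harm_def field_simps)

lemma hsum_half: "hsum (1/2) m = 2 * harm (2*m) - harm m"
proof (induction m)
  case 0 thus ?case by (simp add: hsum_def harm_def)
next
  case (Suc m)
  have "2 * Suc m = Suc (Suc (2*m))" by simp
  hence h: "harm (2 * Suc m) = (harm (2*m) :: real) + 1/(2*m+1) + 1/(2*m+2)"
    by (simp add: harm_Suc field_simps)
  have "hsum (1/2) (Suc m) = 2 * harm (2*m) - harm m + 1/(real m+1/2)"
    using Suc by (simp add: hsum_Suc)
  also have "\<dots> = 2 * harm (2 * Suc m) - harm (Suc m)"
    unfolding h by (simp add: harm_Suc divide_simps) (simp add: algebra_simps)
  finally show ?case .
qed

lemma hsum_nonneg: "c > 0 \<Longrightarrow> hsum c m \<ge> 0"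
  unfolding hsum_def by (intro sum_nonneg) simp

lemma hsum_half_le: "hsum (1/2) m \<le> 2 * harm m"
proof -
  have "hsum (1/2) m \<le> (\<Sum>i<m. 2 * (1 / (real i + 1)))"
    unfolding hsum_def by (intro sum_mono) (simp add: divide_simps)
  also have "\<dots> = 2 * hsum 1 m" unfolding hsum_def by (simp add: sum_distrib_left)
  finally show ?thesis by (simp add: hsum_1)
qed

text \<open>
  A crude substitute for logarithmic growth: any exponent below \<open>1\<close> makes the Euler sums converge
  and the weighted certificates vanish at infinity.
\<close>

lemma harm_le_sqrt: "harm m \<le> 2 * sqrt (real m)"
proof (induction m)
  case (Suc m)
  define a b where "a = sqrt (real m)" and "b = sqrt (real (Suc m))"
  have ab: "a \<ge> 0" "b > 0" "a \<le> b" "b^2 - a^2 = 1" by (auto simp: a_def b_def)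
  have "1 = (b - a) * (b + a)" using ab(4) by algebra
  also have "\<dots> \<le> (b - a) * (2 * b)" using ab by (intro mult_left_mono) auto
  finally have "1 / b \<le> 2 * (b - a)" using ab by (simp add: field_simps)
  moreover have "1 / real (Suc m) \<le> 1 / b"
  proof -
    have "b \<le> real (Suc m)" unfolding b_def by (rule real_le_lsqrt) (auto simp: power2_eq_square)
    thus ?thesis using ab by (simp add: frac_le)
  qed
  ultimately show ?case using Suc by (simp add: harm_Suc a_def b_def inverse_eq_divide)
qed (simp add: harm_def)

lemma summable_harm: "summable (\<lambda>m. harm (Suc m) / (real m + 1)^2)"
proof (rule summable_comparison_test)
  show "summable (\<lambda>m. 2 * (real (Suc m)) powr (-3/2))"
    by (intro summable_mult) (subst summable_Suc_iff, subst summable_real_powr_iff, simp)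
  have "harm (Suc m) / (real m + 1)^2 \<le> 2 * real (Suc m) powr (-3/2)" for m
  proof -
    have "harm (Suc m) / (real m + 1)^2 \<le> 2 * sqrt (Suc m) / (real m + 1)^2"
      by (intro divide_right_mono harm_le_sqrt) auto
    also have "\<dots> = 2 * real (Suc m) powr (1/2) / real (Suc m) powr 2"
      by (simp add: powr_half_sqrt add_ac)
    also have "\<dots> = 2 * real (Suc m) powr (1/2 - 2)" by (subst powr_diff) simp
    finally show ?thesis by simp
  qed
  thus "\<exists>N. \<forall>n\<ge>N. norm (harm (Suc n) / (real n + 1)^2) \<le> 2 * real (Suc n) powr (-3/2)"
    using harm_nonneg by auto
qed

lemma summable_hsum_half: "summable (\<lambda>m. hsum (1/2) (Suc m) / (real m + 1)^2)"
proof (rule summable_comparison_test)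
  show "summable (\<lambda>m. 2 * (harm (Suc m) / (real m + 1)^2))"
    by (intro summable_mult summable_harm)
  show "\<exists>N. \<forall>n\<ge>N. norm (hsum (1/2) (Suc n) / (real n + 1)^2) \<le> 2 * (harm (Suc n) / (real n + 1)^2)"
    using hsum_half_le hsum_nonneg by (auto simp: divide_right_mono)
qed

lemma sums_inverse_shift_diff:
  assumes "c > 0"
  shows "(\<lambda>i. 1 / (real i + c) - 1 / (real (i + m) + c)) sums hsum c m"
proof -
  have part: "(\<Sum>i<N. 1 / (real i + c) - 1 / (real (i + m) + c)) = hsum c m - (\<Sum>i<m. 1 / (real (N + i) + c))" for N
  proof -
    have a: "(\<Sum>i<M + L. f i) = (\<Sum>i<M. f i) + (\<Sum>i<L. f (M + i))" for f :: "nat \<Rightarrow> real" and M L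
      by (induction L) auto
    have "hsum c (N + m) = hsum c N + (\<Sum>i<m. 1 / (real (N + i) + c))"
      unfolding hsum_def a by simp
    moreover have "hsum c (m + N) = hsum c m + (\<Sum>i<N. 1 / (real (i + m) + c))"
      unfolding hsum_def a by (simp add: add_ac)
    ultimately show ?thesis by (simp add: hsum_def sum_subtractf add_ac)
  qed
  have "(\<lambda>N. \<Sum>i<m. 1 / (real (N + i) + c)) \<longlonglongrightarrow> (\<Sum>i<m. 0)"
    by (intro tendsto_sum) real_asymp
  from tendsto_diff[OF tendsto_const[of "hsum c m"] this]
  show ?thesis unfolding sums_def part by simp
qed

text \<open>
  Sum \<open>1 / (x y (y - x))\<close> over all pairs \<open>x < y\<close> in the progression \<open>c, c+1, c+2, \<dots>\<close>. For a fixed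
  difference \<open>y - x = m\<close> the sum over \<open>x\<close> telescopes to \<open>hsum c m / m\<^sup>2\<close>. For a fixed \<open>y\<close>, the
  decomposition \<open>1 / (x (y - x)) = (1/x + 1/(y - x)) / y\<close> gives the terms summed over \<open>j\<close> below.
\<close>

lemma hsum_pairs:
  fixes c :: real
  assumes c: "c > 0" and sm: "summable (\<lambda>m. hsum c (Suc m) / (real m + 1)^2)"
  shows "(\<lambda>j. (hsum c (Suc j) + harm (Suc j)) / (real (Suc j) + c)^2) sums (\<Sum>m. hsum c (Suc m) / (real m + 1)^2)"
proof -
  define f :: "nat \<times> nat \<Rightarrow> real" where
    "f = (\<lambda>(m,i). 1 / ((real m + 1) * (real i + c) * (real (i + Suc m) + c)))"
  define S where "S = (\<Sum>m. hsum c (Suc m) / (real m + 1)^2)"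
  have f0: "f z \<ge> 0" for z using c by (auto simp: f_def split: prod.split)
  have row: "((\<lambda>i. f (m,i)) has_sum (hsum c (Suc m) / (real m + 1)^2)) UNIV" for m
  proof -
    have "f (m,i) = (1 / (real i + c) - 1 / (real (i + Suc m) + c)) / (real m + 1)^2" for i
    proof -
      have "real i + c > 0" "real (i + Suc m) + c > 0" "real m + 1 > 0" using c by auto
      thus ?thesis unfolding f_def by (simp add: divide_simps) algebra
    qed
    hence "(\<lambda>i. f (m,i)) sums (hsum c (Suc m) / (real m + 1)^2)"
      using sums_divide[OF sums_inverse_shift_diff[OF c, of "Suc m"]] by simp
    thus ?thesis using f0 by (intro norm_summable_imp_has_sum) (auto simp: sums_iff)
  qed
  have outer: "((\<lambda>m. hsum c (Suc m) / (real m + 1)^2) has_sum S) UNIV"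
    unfolding S_def using sm hsum_nonneg[OF c] by (intro norm_summable_imp_has_sum) (auto simp: summable_sums)
  have "f summable_on (UNIV \<times> UNIV)"
    using row f0 by (intro summable_on_SigmaI[OF _ has_sum_imp_summable[OF outer]]) auto
  hence tot: "(f has_sum S) (UNIV \<times> UNIV)"
    using row by (intro has_sum_SigmaI[OF _ outer]) auto
  \<comment> \<open>\<open>(j,i)\<close> codes the pair \<open>i+c < j+1+c\<close>, and \<open>(m,i)\<close> the pair with smaller element \<open>i+c\<close> and difference \<open>m+1\<close>\<close>
  have bij: "bij_betw (\<lambda>(j,i). (j - i, i)) (Sigma UNIV (\<lambda>j. {..j})) (UNIV \<times> (UNIV :: nat set))"
    by (rule bij_betwI[where g = "\<lambda>(m,i). (m + i, i)"]) auto
  have "((\<lambda>(j,i). f (j - i, i)) has_sum S) (Sigma UNIV (\<lambda>j. {..j}))"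
    using has_sum_reindex_bij_betw[OF bij, of f S] tot by (simp add: case_prod_unfold)
  moreover have "((\<lambda>i. f (j - i, i)) has_sum ((hsum c (Suc j) + harm (Suc j)) / (real (Suc j) + c)^2)) {..j}" for j
  proof -
    have "(\<Sum>i\<le>j. f (j - i, i)) = (\<Sum>i\<le>j. (1 / (real i + c) + 1 / (real (j - i) + 1)) / (real (Suc j) + c)^2)"
    proof (rule sum.cong[OF refl])
      fix i assume "i \<in> {..j}"
      hence e: "real (j - i) = real j - real i" "i + Suc (j - i) = Suc j" by (auto simp: of_nat_diff)
      have "real i + c > 0" "real j - real i + 1 > 0" "real (Suc j) + c > 0" using c \<open>i \<in> {..j}\<close> by auto
      thus "f (j - i, i) = (1 / (real i + c) + 1 / (real (j - i) + 1)) / (real (Suc j) + c)^2"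
        unfolding f_def by (simp add: e divide_simps) algebra
    qed
    also have "\<dots> = ((\<Sum>i\<le>j. 1 / (real i + c)) + (\<Sum>i\<le>j. 1 / (real (j - i) + 1))) / (real (Suc j) + c)^2"
      by (simp add: sum.distrib sum_divide_distrib add_divide_distrib)
    also have "(\<Sum>i\<le>j. 1 / (real (j - i) + 1)) = harm (Suc j)"
      using sum.nat_diff_reindex[of "\<lambda>i. 1 / (real i + 1)" "Suc j"]
      by (simp add: hsum_1[symmetric] hsum_def lessThan_Suc_atMost)
    also have "(\<Sum>i\<le>j. 1 / (real i + c)) = hsum c (Suc j)" by (simp add: hsum_def lessThan_Suc_atMost)
    finally show ?thesis by (simp add: has_sum_finite_iff)
  qed
  ultimately have "((\<lambda>j. (hsum c (Suc j) + harm (Suc j)) / (real (Suc j) + c)^2) has_sum S) UNIV"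
    using has_sum_SigmaD[where f = "\<lambda>(j,i). f (j - i, i)" and B = "\<lambda>j. {..j}" and A = UNIV and S = S
        and g = "\<lambda>j. (hsum c (Suc j) + harm (Suc j)) / (real (Suc j) + c)^2"] by simp
  thus ?thesis unfolding S_def by (rule has_sum_imp_sums)
qed

lemma zeta3_sums: "(\<lambda>n. 1 / (real n + 1)^3) sums zeta 3"
proof -
  have "summable (\<lambda>n. 1 / (real n + 1)^3)"
    using summable_Suc_iff[THEN iffD2, OF inverse_power_summable[of 3, where 'a = real]]
    by (simp add: inverse_eq_divide add_ac)
  thus ?thesis by (simp add: zeta_def summable_sums add_ac)
qed

text \<open>
  Euler's sum. For \<open>c = 1\<close> both sides of \<open>hsum_pairs\<close> contain the unknown sum \<open>S\<close>, which gives
  \<open>S = 2 (S - \<zeta>(3))\<close>.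
\<close>

lemma sum_harm_over_squares: "(\<lambda>m. harm (Suc m) / (real m + 1)^2) sums (2 * zeta 3)"
proof -
  define S where "S = (\<Sum>m. harm (Suc m) / (real m + 1)^2 :: real)"
  define h where "h = (\<lambda>m. harm (Suc m) / (real m + 1)^2 - 1 / (real m + 1)^3)"
  have S: "(\<lambda>m. harm (Suc m) / (real m + 1)^2) sums S"
    unfolding S_def by (intro summable_sums summable_harm)
  have h: "h sums (S - zeta 3)" unfolding h_def by (intro sums_diff S zeta3_sums)
  have h': "h (Suc j) = harm (Suc j) / (real (Suc j) + 1)^2" for j
    unfolding h_def by (simp add: harm_Suc[of "Suc j"] divide_simps) (simp add: algebra_simps power3_eq_cube power2_eq_square)
  have "(\<lambda>j. 2 * h (Suc j)) sums S"
    using hsum_pairs[of 1] summable_harm unfolding S_def h' by (simp add: hsum_1)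
  moreover have "h 0 = 0" by (simp add: h_def harm_def)
  hence "(\<lambda>j. 2 * h (Suc j)) sums (2 * (S - zeta 3))"
    using h by (intro sums_mult) (simp add: sums_Suc_iff)
  ultimately have "S = 2 * (S - zeta 3)" by (rule sums_unique2)
  thus ?thesis using S by simp
qed

lemma sums_pairs:
  fixes f :: "nat \<Rightarrow> real"
  assumes "f sums s"
  shows "(\<lambda>j. f (2*j) + f (2*j+1)) sums s"
  using sums_group[OF assms, of 2] by (simp add: eval_nat_numeral mult_2 mult_2_right)

lemma zeta3_odd_sums: "(\<lambda>j. 1 / (2 * real j + 1)^3) sums (7/8 * zeta 3)"
proof -
  have "(\<lambda>j. 1 / (2 * real j + 1)^3 + 1 / (2 * real j + 2)^3 - 1/8 * (1 / (real j + 1)^3)) sums (zeta 3 - 1/8 * zeta 3)"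
    using sums_diff[OF sums_pairs[OF zeta3_sums] sums_mult[OF zeta3_sums, of "1/8"]] by (simp add: add_ac)
  moreover have "1 / (2 * real j + 2)^3 = 1/8 * (1 / (real j + 1)^3)" for j
  proof -
    have "2 * real j + 2 = 2 * (real j + 1)" by simp
    thus ?thesis by (simp only: power_mult_distrib) simp
  qed
  ultimately show ?thesis by simp
qed

text \<open>
  Let \<open>S\<close> be the sum. Split Euler's sum of \<open>H N / N\<^sup>2\<close> into the part over odd \<open>N\<close> (with terms \<open>d\<close>)
  and the part over even \<open>N\<close> (with terms \<open>e\<close>). By \<open>O m = 2 H (2m) - H m\<close>, eight times the even part
  is \<open>S + 2 \<zeta>(3)\<close>. By \<open>hsum_pairs\<close> for \<open>c = 1/2\<close>, eight times the odd part is \<open>S + 7 \<zeta>(3)\<close>. The two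
  parts add up to \<open>2 \<zeta>(3)\<close>.
\<close>

lemma sum_hsum_half_over_squares: "(\<lambda>m. hsum (1/2) (Suc m) / (real m + 1)^2) sums (7/2 * zeta 3)"
proof -
  define S where "S = (\<Sum>m. hsum (1/2) (Suc m) / (real m + 1)^2)"
  have S: "(\<lambda>m. hsum (1/2) (Suc m) / (real m + 1)^2) sums S"
    unfolding S_def by (intro summable_sums summable_hsum_half)
  define d e where "d = (\<lambda>j. harm (2*j+1) / (2 * real j + 1)^2 :: real)" and "e = (\<lambda>j. harm (2*j+2) / (2 * real j + 2)^2 :: real)"
  have de: "(\<lambda>j. d j + e j) sums (2 * zeta 3)"
    using sums_pairs[OF sum_harm_over_squares] by (simp add: d_def e_def add_ac)
  have "(\<lambda>j. (hsum (1/2) (Suc j) + harm (Suc j)) / (real (Suc j) + 1/2)^2) sums S"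
    using hsum_pairs[of "1/2", OF _ summable_hsum_half] by (simp add: S_def)
  moreover have "(hsum (1/2) j + harm j) / (real j + 1/2)^2 = 8 * (d j - 1 / (2 * real j + 1)^3)" for j
  proof -
    have "real j + 1/2 = (2 * real j + 1) / 2" by simp
    hence "(real j + 1/2)^2 = (2 * real j + 1)^2 / 4" by (simp only: power_divide) simp
    moreover have "d j - 1 / (2 * real j + 1)^3 = harm (2*j) / (2 * real j + 1)^2"
      unfolding d_def by (simp add: harm_Suc inverse_eq_divide add_divide_distrib power3_eq_cube power2_eq_square)
    moreover have "2 * a / (b / 4) = 8 * (a / b)" for a b :: real by simp
    ultimately show ?thesis unfolding hsum_half by (simp only: diff_add_cancel)
  qed
  ultimately have "(\<lambda>j. 8 * (d (Suc j) - 1 / (2 * real (Suc j) + 1)^3)) sums S"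
    by (simp only:)
  moreover have "d 0 - 1 / (2 * real 0 + 1)^3 = 0" by (simp add: d_def harm_def)
  ultimately have "(\<lambda>j. 8 * (d j - 1 / (2 * real j + 1)^3)) sums S"
    by (subst (asm) sums_Suc_iff) simp
  from sums_add[OF this sums_mult[OF zeta3_odd_sums, of 8]]
  have d: "(\<lambda>j. 8 * d j) sums (S + 7 * zeta 3)" by (simp add: algebra_simps)
  have "hsum (1/2) (Suc j) / (real j + 1)^2 = 8 * e j - harm (Suc j) / (real j + 1)^2" for j
  proof -
    have "2 * real j + 2 = 2 * (real j + 1)" by simp
    hence "(2 * real j + 2)^2 = 4 * (real j + 1)^2" by (simp only: power_mult_distrib) simp
    thus ?thesis by (simp add: e_def hsum_half diff_divide_distrib)
  qed
  hence "(\<lambda>j. 8 * e j - harm (Suc j) / (real j + 1)^2) sums S" using S by simp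
  from sums_add[OF this sum_harm_over_squares] have e: "(\<lambda>j. 8 * e j) sums (S + 2 * zeta 3)" by simp
  have "(\<lambda>j. 8 * (d j + e j)) sums (2 * S + 9 * zeta 3)"
    using sums_add[OF d e] by (simp add: algebra_simps)
  moreover have "(\<lambda>j. 8 * (d j + e j)) sums (16 * zeta 3)" using sums_mult[OF de, of 8] by simp
  ultimately have "2 * S + 9 * zeta 3 = 16 * zeta 3" by (rule sums_unique2)
  hence "S = 7/2 * zeta 3" by simp
  thus ?thesis using S by (simp only:)
qed

section \<open>The rational certificates\<close>

text \<open>
  These polynomials arise as follows. Solving the WZ equation for \<open>G\<^sub>\<epsilon>\<close> (Gosper's algorithm) gives a
  polynomial numerator of degree \<open>5\<close> in \<open>k\<close>. Its value at \<open>\<epsilon> = 0\<close> is \<open>cert_poly\<close> up to scaling;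
  \<open>cert_poly1\<close> and \<open>cert_poly2\<close> are, up to scaling and sign, the numerators of what differentiation in
  the two directions adds to the logarithmic derivative. The arguments \<open>x\<close> and \<open>y\<close> stand for \<open>n\<close> and \<open>k\<close>.
\<close>

definition cert_poly :: "real \<Rightarrow> real \<Rightarrow> real" where
  "cert_poly x y = (396 + 3236*x + 10760*x^2 + 18640*x^3 + 17760*x^4 + 8832*x^5 + 1792*x^6)
    + (1199 + 8030*x + 21080*x^2 + 27160*x^3 + 17200*x^4 + 4288*x^5) * y
    + (1440 + 7548*x + 14604*x^2 + 12384*x^3 + 3888*x^4) * y^2
    + (860 + 3302*x + 4184*x^2 + 1752*x^3) * y^3
    + (255 + 636*x + 396*x^2) * y^4 + (30 + 36*x) * y^5"

definition cert_poly1 :: "real \<Rightarrow> real \<Rightarrow> real" where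
  "cert_poly1 x y = (760 + 5360*x + 15320*x^2 + 22720*x^3 + 18400*x^4 + 7680*x^5 + 1280*x^6)
    + (2051 + 12156*x + 28264*x^2 + 32256*x^3 + 18064*x^4 + 3968*x^5) * y
    + (2155 + 10232*x + 17976*x^2 + 13856*x^3 + 3952*x^4) * y^2
    + (1120 + 3984*x + 4688*x^2 + 1824*x^3) * y^3
    + (290 + 688*x + 408*x^2) * y^4 + (30 + 36*x) * y^5"

definition cert_poly2 :: "real \<Rightarrow> real \<Rightarrow> real" where
  "cert_poly2 x y = (388 + 3212*x + 10808*x^2 + 18896*x^3 + 18080*x^4 + 8960*x^5 + 1792*x^6)
    + (1037 + 7210*x + 19656*x^2 + 26264*x^3 + 17200*x^4 + 4416*x^5) * y
    + (1088 + 6060*x + 12444*x^2 + 11168*x^3 + 3696*x^4) * y^2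
    + (572 + 2398*x + 3304*x^2 + 1496*x^3) * y^3
    + (151 + 428*x + 300*x^2) * y^4 + (16 + 24*x) * y^5"

lemma cert_poly_identity:
  "- 2 * (x + y + 2) * (2*x+1)^5 * (2*x+2)^3
    - 6 * ((6*x+1)*(6*x+5)) * (x + y + 1) * (2*x+y+2)^3 * (2*x+y+3)^3
    = (y+1)^3 * cert_poly x (y+1) - (2*x+y+3)^3 * cert_poly x y"
  unfolding cert_poly_def by algebra

text \<open>
  The quotients \<open>\<sigma> (n+1) k / \<sigma> n k\<close> and \<open>\<sigma> n (k+1) / \<sigma> n k\<close> of the kernel \<open>\<sigma>\<close> defined below.
\<close>

definition \<rho> :: "real \<Rightarrow> real \<Rightarrow> real" where
  "\<rho> x y = - ((2*x+1)^5 * (2*x+2)^3) / (3 * ((6*x+1)*(6*x+5)) * (2*x+y+2)^3 * (2*x+y+3)^3)"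
definition \<kappa> :: "real \<Rightarrow> real \<Rightarrow> real" where
  "\<kappa> x y = (y+1)^3 / (2*x+y+2)^3"
definition cert :: "real \<Rightarrow> real \<Rightarrow> real" where
  "cert x y = cert_poly x y / (6 * ((6*x+1)*(6*x+5)) * (2*x+y+2)^3)"
definition cert1 :: "real \<Rightarrow> real \<Rightarrow> real" where
  "cert1 x y = - cert_poly1 x y / (24 * ((6*x+1)*(6*x+5)) * (2*x+y+2)^4)"
definition cert2 :: "real \<Rightarrow> real \<Rightarrow> real" where
  "cert2 x y = - cert_poly2 x y / (((6*x+1)*(6*x+5)) * (6*x+3) * (2*x+y+2)^3)"

text \<open>
  The next two lemmas contain the WZ equations of the two weighted pairs as polynomial identities. The
  denominators are cleared, and from the second equation a multiple of the unweighted one is subtracted.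
\<close>

lemma cert_poly1_identity:
  fixes x y :: real
  defines "p \<equiv> 2*x+1" and "q \<equiv> 2*x+2" and "u \<equiv> 2*x+y+2" and "v \<equiv> 2*x+y+3" and "w \<equiv> 2*x+2*y+3"
  shows "- 10 * (x+y+2) * p^4 * q^2 * u * v * (p*w - q*w + 2*p*q) + 2 * (x+y+2) * p^5 * q^3 * w * (u+v)
     + p^5 * q^3 * u * v * w + 3 * ((6*x+1)*(6*x+5)) * u^4 * v^4 * w
   = (y+1)^2 * cert_poly x (y+1) * v * (10*(y+1)*u - (y+1)*w - 4*u*w) - (y+1)^3 * cert_poly1 x (y+1) * u * w + cert_poly1 x y * v^4 * w"
  unfolding cert_poly_def cert_poly1_def p_def q_def u_def v_def w_def by algebra

lemma cert_poly2_identity: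
  fixes x y :: real
  defines "p \<equiv> 2*x+1" and "q \<equiv> 2*x+2" and "u \<equiv> 2*x+y+2" and "v \<equiv> 2*x+y+3" and "w \<equiv> 2*x+2*y+3"
  shows "- (p^5 * q^3 * (x+y+2) * (4*p - 6*w))
     + (x+y+1) * (2 * ((6*x+3)*(6*x+5) + (6*x+1)*(6*x+5) + (6*x+1)*(6*x+3))) * u^3 * v^3 * w
   = 2 * p * (y+1)^3 * cert_poly x (y+1) - (y+1)^3 * cert_poly2 x (y+1) * w + cert_poly2 x y * v^3 * w"
  unfolding cert_poly_def cert_poly2_def p_def q_def u_def v_def w_def by algebra

text \<open>
  The WZ equation of the unweighted pair \<open>\<sigma> n k * (n+k+1)\<close> and \<open>\<sigma> n k * cert n k\<close>, divided by \<open>\<sigma> n k\<close>.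
\<close>

lemma cert_identity:
  assumes "x \<ge> 0" "y \<ge> 0"
  shows "\<rho> x y * (x+y+2) - (x+y+1) = \<kappa> x y * cert x (y+1) - cert x y"
proof -
  define D p q u v where "D = (6*x+1)*(6*x+5)" and "p = 2*x+1" and "q = 2*x+2" and "u = 2*x+y+2" and "v = 2*x+y+3"
  have pos: "D \<noteq> 0" "u \<noteq> 0" "v \<noteq> 0"
    using assms by (auto simp: D_def u_def v_def)
  have v: "2*x+(y+1)+2 = v" by (simp add: v_def)
  let ?M = "6 * D * u^3 * v^3"
  have 1: "\<rho> x y * ?M = - 2 * p^5 * q^3"
    unfolding \<rho>_def D_def[symmetric] p_def[symmetric] q_def[symmetric] u_def[symmetric] v_def[symmetric]
    using pos by (simp add: divide_simps)
  have 2: "\<kappa> x y * cert x (y+1) * ?M = (y+1)^3 * cert_poly x (y+1)"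
    unfolding \<kappa>_def cert_def v D_def[symmetric] u_def[symmetric] using pos by (simp add: divide_simps)
  have 3: "cert x y * ?M = v^3 * cert_poly x y"
    unfolding cert_def D_def[symmetric] u_def[symmetric] using pos by (simp add: divide_simps)
  have "(\<rho> x y * (x+y+2) - (x+y+1)) * ?M = (\<kappa> x y * cert x (y+1) - cert x y) * ?M"
    using cert_poly_identity[of x y] 1 2 3
    unfolding D_def[symmetric] p_def[symmetric] q_def[symmetric] u_def[symmetric] v_def[symmetric]
    by algebra
  thus ?thesis using pos by simp
qed

text \<open>
  The increments in \<open>n\<close> and in \<open>k\<close> of the function \<open>weight1\<close> below.
\<close>

definition step1n :: "real \<Rightarrow> real \<Rightarrow> real" where
  "step1n x y = 5/4 * (1/(2*x+2) - 1/(2*x+1) + 2/(2*x+2*y+3)) - 1/4 * (1/(2*x+y+2) + 1/(2*x+y+3))"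
definition step1k :: "real \<Rightarrow> real \<Rightarrow> real" where
  "step1k x y = 5/4 * (2/(2*x+2*y+3)) - 1/4 * (1/(2*x+y+2)) - 1/(y+1)"

text \<open>
  If a weight \<open>w\<close> with increments \<open>\<Delta>\<close> is put on a WZ pair, the terms with \<open>w\<close> itself cancel by the
  unweighted equation. What the increments leave over has to be compensated by a rational
  correction of \<open>F\<close> and \<open>G\<close>: here \<open>-1/8\<close>, the derivative \<open>5/24 - 1/3\<close> of the factor \<open>n+k+1\<close>, and
  \<open>cert1\<close>.
\<close>

lemma cert1_identity:
  assumes "x \<ge> 0" "y \<ge> 0"
  shows "\<rho> x y * ((x+y+2) * step1n x y - 1/8) + 1/8 = \<kappa> x y * (cert x (y+1) * step1k x y + cert1 x (y+1)) - cert1 x y"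
proof -
  define D p q u v w where "D = (6*x+1)*(6*x+5)" and "p = 2*x+1" and "q = 2*x+2" and "u = 2*x+y+2" and "v = 2*x+y+3"
    and "w = 2*x+2*y+3"
  note defs = D_def[symmetric] p_def[symmetric] q_def[symmetric] u_def[symmetric] v_def[symmetric] w_def[symmetric]
  have pos: "D \<noteq> 0" "p \<noteq> 0" "q \<noteq> 0" "u \<noteq> 0" "v \<noteq> 0" "w \<noteq> 0" "y+1 \<noteq> 0"
    using assms by (auto simp: D_def p_def q_def u_def v_def w_def)
  have v: "2*x+(y+1)+2 = v" by (simp add: v_def)
  have n: "step1n x y * (4 * p * q * u * v * w) = 5 * u * v * (p*w - q*w + 2*p*q) - p * q * w * (u + v)"
    unfolding step1n_def defs using pos by (simp add: divide_simps) algebra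
  have k: "step1k x y * (4 * u * w * (y+1)) = 10*(y+1)*u - (y+1)*w - 4*u*w"
    unfolding step1k_def defs using pos by (simp add: divide_simps) algebra
  let ?M = "24 * D * u^4 * v^4 * w"
  have 1: "\<rho> x y * (3 * D * u^3 * v^3) = - (p^5 * q^3)"
    unfolding \<rho>_def defs using pos by (simp add: divide_simps)
  have 2: "\<kappa> x y * cert x (y+1) * (6 * D * u^3 * v^3) = (y+1)^3 * cert_poly x (y+1)"
    unfolding \<kappa>_def cert_def v defs using pos by (simp add: divide_simps)
  have 3: "\<kappa> x y * cert1 x (y+1) * (24 * D * u^3 * v^4) = - ((y+1)^3 * cert_poly1 x (y+1))"
    unfolding \<kappa>_def cert1_def v defs using pos by (simp add: divide_simps)
  have 4: "cert1 x y * (24 * D * u^4) = - cert_poly1 x y"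
    unfolding cert1_def defs using pos by (simp add: divide_simps)
  have "\<rho> x y * ((x+y+2) * step1n x y - 1/8) * ?M
      = - 2 * (x+y+2) * p^4 * q^2 * (step1n x y * (4 * p * q * u * v * w)) + p^5 * q^3 * u * v * w"
    using 1 by algebra
  hence l: "\<rho> x y * ((x+y+2) * step1n x y - 1/8) * ?M
      = - 10 * (x+y+2) * p^4 * q^2 * u * v * (p*w - q*w + 2*p*q) + 2 * (x+y+2) * p^5 * q^3 * w * (u+v)
     + p^5 * q^3 * u * v * w"
    unfolding n by algebra
  have "\<kappa> x y * cert x (y+1) * step1k x y * ?M = (y+1)^2 * cert_poly x (y+1) * v * (step1k x y * (4 * u * w * (y+1)))"
    using 2 by algebra
  hence r: "\<kappa> x y * cert x (y+1) * step1k x y * ?M = (y+1)^2 * cert_poly x (y+1) * v * (10*(y+1)*u - (y+1)*w - 4*u*w)"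
    unfolding k .
  have "(\<rho> x y * ((x+y+2) * step1n x y - 1/8) + 1/8) * ?M
      = (\<kappa> x y * (cert x (y+1) * step1k x y + cert1 x (y+1)) - cert1 x y) * ?M"
    using cert_poly1_identity[of x y] l r 3 4 unfolding defs by algebra
  thus ?thesis using pos by simp
qed

text \<open>
  The increment of \<open>O (3n)\<close> in \<open>n\<close>. In the second pair the weight of \<open>G\<close> exceeds that of \<open>F\<close> by this
  amount, since the denominator of the certificate turns \<open>\<Gamma>(3n+1/2-\<epsilon>)\<close> into \<open>\<Gamma>(3n+7/2-\<epsilon>)\<close>.
\<close>

definition step2 :: "real \<Rightarrow> real" where "step2 x = 2/(6*x+1) + 2/(6*x+3) + 2/(6*x+5)"

lemma cert2_identity:
  assumes "x \<ge> 0" "y \<ge> 0"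
  shows "\<rho> x y * ((x+y+2) * (4/(2*x+2*y+3) - 6/(2*x+1) + step2 x)) =
     \<kappa> x y * (cert x (y+1) * (4/(2*x+2*y+3) + step2 x) + cert2 x (y+1)) - (cert x y * step2 x + cert2 x y)"
proof -
  define D p q u v w where "D = (6*x+1)*(6*x+5)" and "p = 2*x+1" and "q = 2*x+2" and "u = 2*x+y+2" and "v = 2*x+y+3"
    and "w = 2*x+2*y+3"
  note defs = D_def[symmetric] p_def[symmetric] q_def[symmetric] u_def[symmetric] v_def[symmetric] w_def[symmetric]
  have p3: "6*x+3 = 3*p" by (simp add: p_def)
  have pos: "D \<noteq> 0" "p \<noteq> 0" "q \<noteq> 0" "u \<noteq> 0" "v \<noteq> 0" "w \<noteq> 0" "y+1 \<noteq> 0"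
    using assms by (auto simp: D_def p_def q_def u_def v_def w_def)
  have v: "2*x+(y+1)+2 = v" by (simp add: v_def)
  define T where "T = 2 * ((6*x+3)*(6*x+5) + (6*x+1)*(6*x+5) + (6*x+1)*(6*x+3))"
  have t: "step2 x * (3 * D * p) = T"
  proof -
    have "6*x+1 \<noteq> 0" "6*x+5 \<noteq> 0" "6*x+3 \<noteq> 0" using assms by auto
    thus ?thesis unfolding step2_def D_def T_def p3[symmetric] mult.assoc
      by (simp add: divide_simps p_def) algebra
  qed
  let ?M = "3 * D * p * u^3 * v^3 * w"
  have 1: "\<rho> x y * (3 * D * u^3 * v^3) = - (p^5 * q^3)"
    unfolding \<rho>_def defs using pos by (simp add: divide_simps)
  have 2: "\<kappa> x y * cert x (y+1) * (6 * D * u^3 * v^3) = (y+1)^3 * cert_poly x (y+1)"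
    unfolding \<kappa>_def cert_def v defs using pos by (simp add: divide_simps)
  have 3: "\<kappa> x y * cert2 x (y+1) * (3 * D * p * u^3 * v^3) = - ((y+1)^3 * cert_poly2 x (y+1))"
    unfolding \<kappa>_def cert2_def v p3 defs using pos by (simp add: divide_simps)
  have 4: "cert2 x y * (3 * D * p * u^3) = - cert_poly2 x y"
    unfolding cert2_def p3 defs using pos by (simp add: divide_simps)
  have l: "(4/w - 6/p) * (p * w) = 4 * p - 6 * w" using pos by (simp add: divide_simps)
  have l': "4/w * w = 4" using pos by simp
  have "\<rho> x y * (x+y+2) * (4/w - 6/p) * ?M = \<rho> x y * (3 * D * u^3 * v^3) * (x+y+2) * ((4/w - 6/p) * (p * w))"
    by algebra
  hence a: "\<rho> x y * (x+y+2) * (4/w - 6/p) * ?M = - (p^5 * q^3 * (x+y+2) * (4*p - 6*w))"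
    unfolding l 1 by simp
  have b: "\<kappa> x y * cert x (y+1) * (4/w) * ?M = 2 * p * (y+1)^3 * cert_poly x (y+1)"
  proof -
    obtain z where z: "z = 4/w" "z * w = 4" using l' by blast
    have "2 * (\<kappa> x y * cert x (y+1) * z * ?M) = \<kappa> x y * cert x (y+1) * (6 * D * u^3 * v^3) * (z * w) * p"
      by (simp add: mult_ac)
    thus ?thesis unfolding z(2) 2 unfolding z(1) by simp
  qed
  have c: "(x+y+1) * step2 x * ?M = (x+y+1) * T * u^3 * v^3 * w"
    unfolding t[symmetric] by (simp add: mult_ac)
  have d: "\<kappa> x y * cert2 x (y+1) * ?M = - ((y+1)^3 * cert_poly2 x (y+1) * w)"
    using arg_cong[OF 3, of "\<lambda>z. z * w"] by (simp add: mult_ac)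
  have e: "cert2 x y * ?M = - cert_poly2 x y * v^3 * w"
    using arg_cong[OF 4, of "\<lambda>z. z * v^3 * w"] by (simp add: mult_ac)
  have "\<rho> x y * (x+y+2) * (4/w - 6/p) * ?M + (x+y+1) * step2 x * ?M
     = \<kappa> x y * cert x (y+1) * (4/w) * ?M + \<kappa> x y * cert2 x (y+1) * ?M - cert2 x y * ?M"
    unfolding a b c d e using cert_poly2_identity[of x y] unfolding T_def[symmetric] unfolding defs by simp
  hence "(\<rho> x y * (x+y+2) * (4/w - 6/p) + (x+y+1) * step2 x) * ?M
     = (\<kappa> x y * cert x (y+1) * (4/w) + \<kappa> x y * cert2 x (y+1) - cert2 x y) * ?M" by algebra
  hence "\<rho> x y * (x+y+2) * (4/w - 6/p) + (x+y+1) * step2 x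
     = \<kappa> x y * cert x (y+1) * (4/w) + \<kappa> x y * cert2 x (y+1) - cert2 x y" using pos by simp
  thus ?thesis using cert_identity[OF assms] unfolding defs by algebra
qed

section \<open>The hypergeometric kernel\<close>

text \<open>
  This is \<open>(-1)\<^sup>n \<Gamma>(n+1/2)\<^sup>3 / \<Gamma>(3n+1/2)\<close> up to a constant factor, by the duplication formula.
\<close>

definition alt_coeff :: "nat \<Rightarrow> real" where
  "alt_coeff n = (-1)^n * fact (2*n)^3 * fact (3*n) / (fact n^3 * fact (6*n))"

text \<open>
  The Euler beta value \<open>B(k+1, 2n+1)\<close>.
\<close>

definition beta :: "nat \<Rightarrow> nat \<Rightarrow> real" where
  "beta n k = fact k * fact (2*n) / fact (2*n+k+1)"

definition \<sigma> :: "nat \<Rightarrow> nat \<Rightarrow> real" where "\<sigma> n k = alt_coeff n * beta n k ^ 3"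

lemma alt_coeff_Suc: "alt_coeff (Suc n) = - ((2*real n+1)^2 / (3 * ((6*real n+1)*(6*real n+5)))) * alt_coeff n"
proof -
  define x where "x = real n"
  have x: "x \<ge> 0" by (simp add: x_def)
  have 1: "fact (2 * Suc n) = (2*x+2)*(2*x+1) * (fact (2*n) :: real)"
    unfolding x_def by (simp add: eval_nat_numeral algebra_simps)
  have 2: "fact (3 * Suc n) = (3*x+3)*(3*x+2)*(3*x+1) * (fact (3*n) :: real)"
    unfolding x_def by (simp add: eval_nat_numeral algebra_simps)
  have e: "6 * Suc n = Suc (Suc (Suc (Suc (Suc (Suc (6*n))))))" by simp
  have 3: "fact (6 * Suc n) = (6*x+6)*(6*x+5)*(6*x+4)*(6*x+3)*(6*x+2)*(6*x+1) * (fact (6*n) :: real)"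
    unfolding x_def e fact_Suc by (simp add: mult_ac add_ac)
  have 4: "fact (Suc n) = (x+1) * (fact n :: real)" unfolding x_def by (simp add: algebra_simps)
  have pos: "x+1 \<noteq> 0" "3*x+2 \<noteq> 0" "3*x+1 \<noteq> 0" "2*x+1 \<noteq> 0" "6*x+1 \<noteq> 0" "6*x+5 \<noteq> 0" using x by auto
  have f: "2*x+2 = 2*(x+1)" "3*x+3 = 3*(x+1)" "6*x+6 = 6*(x+1)" "6*x+4 = 2*(3*x+2)" "6*x+2 = 2*(3*x+1)" "6*x+3 = 3*(2*x+1)" by auto
  define a b c d s where "a = (fact n :: real)" and "b = (fact (2*n) :: real)" and "c = (fact (3*n) :: real)"
    and "d = (fact (6*n) :: real)" and "s = (-1 :: real)^n"
  have cross: "- (p^2 * (s * b^3 * c)) * ((t * a)^3 * (6 * t * w5 * (2 * v2) * (3 * p) * (2 * v1) * w1 * d))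
      = - 1 * s * (2 * t * p * b)^3 * (3 * t * v2 * v1 * c) * (3 * (w1 * w5) * (a^3 * d))" for p t v1 v2 w1 w5
    by (simp add: power2_eq_square power3_eq_cube mult_ac)
  have nz: "a \<noteq> 0" "b \<noteq> 0" "c \<noteq> 0" "d \<noteq> 0" by (auto simp: a_def b_def c_def d_def)
  have "- ((2*x+1)^2 / (3 * ((6*x+1)*(6*x+5)))) * alt_coeff n
      = - ((2*x+1)^2 * (s * b^3 * c)) / (3 * ((6*x+1)*(6*x+5)) * (a^3 * d))"
    by (simp add: alt_coeff_def a_def b_def c_def d_def s_def)
  also have "\<dots> = alt_coeff (Suc n)"
  proof -
    have "3 * ((6*x+1) * (6*x+5)) * (a^3 * d) \<noteq> 0" using pos nz by simp
    moreover have "((x+1) * a)^3 * (6 * (x+1) * (6*x+5) * (2 * (3*x+2)) * (3 * (2*x+1)) * (2 * (3*x+1)) * (6*x+1) * d) \<noteq> 0"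
      using pos nz by (simp del: distrib_left_numeral)
    ultimately show ?thesis
      unfolding alt_coeff_def 1 2 3 4 f a_def[symmetric] b_def[symmetric] c_def[symmetric] d_def[symmetric] power_Suc s_def[symmetric]
      by (subst frac_eq_eq) (assumption, assumption, rule cross)
  qed
  finally show ?thesis by (simp only: x_def)
qed

lemma abs_alt_coeff_le: "\<bar>alt_coeff n\<bar> \<le> (1/3)^n"
proof (induction n)
  case (Suc n)
  define x where "x = real n"
  have x: "x \<ge> 0" by (simp add: x_def)
  have "(2*x+1)^2 \<le> (6*x+1)*(6*x+5)" using x by (simp add: power2_eq_square algebra_simps)
  hence "\<bar>- ((2*x+1)^2 / (3 * ((6*x+1)*(6*x+5))))\<bar> \<le> 1/3" using x by (simp add: abs_mult divide_simps)
  from mult_mono[OF this Suc] show ?case by (simp only: alt_coeff_Suc abs_mult x_def[symmetric] power_Suc abs_ge_zero)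
qed (simp add: alt_coeff_def)

lemma beta_Suc_n: "beta (Suc n) k = (2*real n+1)*(2*real n+2) / ((2*real n+real k+2)*(2*real n+real k+3)) * beta n k"
proof -
  have "2 * Suc n = Suc (Suc (2*n))" "2 * Suc n + k + 1 = Suc (Suc (2*n+k+1))" by auto
  hence f: "fact (2 * Suc n) = (2*real n+2) * ((2*real n+1) * fact (2*n))"
      "fact (2 * Suc n + k + 1) = (2*real n+real k+3) * ((2*real n+real k+2) * fact (2*n+k+1))"
    by (simp_all only: fact_Suc) (simp_all add: add_ac)
  show ?thesis unfolding beta_def f by (simp add: mult_ac)
qed

lemma beta_Suc_k: "beta n (Suc k) = (real k+1) / (2*real n+real k+2) * beta n k"
proof -
  have "2*n + Suc k + 1 = Suc (2*n+k+1)" by auto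
  hence f: "fact (2*n + Suc k + 1) = (2*real n+real k+2) * fact (2*n+k+1)" "fact (Suc k) = (real k+1) * fact k"
    by (simp_all only: fact_Suc) (simp_all add: add_ac)
  show ?thesis unfolding beta_def f by simp
qed

lemma beta_nonneg: "beta n k \<ge> 0" by (simp add: beta_def)

lemma beta_0: "beta 0 k = 1 / (real k + 1)"
  by (simp add: beta_def add_ac)

lemma beta_antimono: "m \<le> n \<Longrightarrow> beta n k \<le> beta m k"
proof (rule lift_Suc_antimono_le[of "\<lambda>n. beta n k"])
  fix n
  have "(2*real n+1)*(2*real n+2) \<le> (2*real n+real k+2)*(2*real n+real k+3)"
    by (rule mult_mono) simp_all
  hence "(2*real n+1)*(2*real n+2) / ((2*real n+real k+2)*(2*real n+real k+3)) \<le> 1"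
    by (rule divide_le_eq_1_pos[THEN iffD2, rotated]) (simp add: add_nonneg_pos)
  from mult_right_mono[OF this beta_nonneg] show "beta (Suc n) k \<le> beta n k"
    unfolding beta_Suc_n[of n k] by (simp only: mult_1_left)
qed

lemma beta_le: "beta n k \<le> 1 / (real k + 1)"
  using beta_antimono[of 0 n k] by (simp only: beta_0)

lemma beta_Suc_le: "beta (Suc n) k \<le> 2 / (real k + 1)^3"
proof -
  have "beta (Suc n) k \<le> beta (Suc 0) k" by (rule beta_antimono) simp
  also have "beta (Suc 0) k = 2 / ((real k + 2) * (real k + 3) * (real k + 1))"
    unfolding beta_Suc_n beta_0 by simp
  also have "\<dots> \<le> 2 / (real k + 1)^3"
  proof (rule divide_left_mono)
    have "(real k + 1) * (real k + 1) * (real k + 1) \<le> (real k + 2) * (real k + 3) * (real k + 1)"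
      by (intro mult_mono) simp_all
    thus "(real k + 1)^3 \<le> (real k + 2) * (real k + 3) * (real k + 1)" by (simp only: power3_eq_cube)
  qed simp_all
  finally show ?thesis .
qed

lemma \<sigma>_Suc_n: "\<sigma> (Suc n) k = \<rho> (real n) (real k) * \<sigma> n k"
proof -
  have gen: "- (p^2 / (3*E)) * a * (p * q / (u * v) * b)^3 = - (p^5 * q^3) / (3 * E * u^3 * v^3) * (a * b^3)"
    for p q u v E a b :: real
  proof -
    have "p^5 = p^2 * p^3" by (simp flip: power_add)
    thus ?thesis by (simp add: power_mult_distrib power_divide mult_ac)
  qed
  show ?thesis unfolding \<sigma>_def alt_coeff_Suc beta_Suc_n \<rho>_def by (rule gen)
qed

lemma \<sigma>_Suc_k: "\<sigma> n (Suc k) = \<kappa> (real n) (real k) * \<sigma> n k"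
  unfolding \<sigma>_def beta_Suc_k \<kappa>_def by (simp add: power_mult_distrib power_divide)

lemma \<sigma>_le: "\<bar>\<sigma> n k\<bar> \<le> 1 / (real k + 1)^3"
proof -
  have "\<bar>alt_coeff n\<bar> \<le> 1" using abs_alt_coeff_le[of n] by (rule order_trans) (simp add: power_le_one)
  moreover have "beta n k ^ 3 \<le> (1 / (real k + 1))^3" by (intro power_mono beta_le beta_nonneg)
  ultimately have "\<bar>alt_coeff n\<bar> * beta n k ^ 3 \<le> 1 * (1 / (real k + 1))^3" by (intro mult_mono) (auto simp: beta_nonneg)
  thus ?thesis by (simp add: \<sigma>_def abs_mult beta_nonneg power_divide)
qed

lemma \<sigma>_Suc_le: "\<bar>\<sigma> (Suc n) k\<bar> \<le> (1/3)^n * (8 / (real k + 1)^4)"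
proof -
  have "\<bar>alt_coeff (Suc n)\<bar> \<le> (1/3)^n" using abs_alt_coeff_le[of "Suc n"] by (rule order_trans) simp
  moreover have "beta (Suc n) k ^ 3 \<le> 8 / (real k + 1)^4"
  proof -
    have "beta (Suc n) k ^ 3 \<le> (2 / (real k + 1)^3)^3" by (intro power_mono beta_Suc_le beta_nonneg)
    also have "\<dots> = 8 / (real k + 1)^9" by (simp add: power_divide)
    also have "\<dots> \<le> 8 / (real k + 1)^4" by (intro divide_left_mono power_increasing) auto
    finally show ?thesis .
  qed
  ultimately have "\<bar>alt_coeff (Suc n)\<bar> * beta (Suc n) k ^ 3 \<le> (1/3)^n * (8 / (real k + 1)^4)"
    by (rule mult_mono) (simp_all add: beta_nonneg)
  thus ?thesis by (simp add: \<sigma>_def abs_mult beta_nonneg)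
qed

lemma quintic_le:
  fixes y :: real
  assumes "y \<ge> 0" "c0 \<ge> 0" "c1 \<ge> 0" "c2 \<ge> 0" "c3 \<ge> 0" "c4 \<ge> 0" "c5 \<ge> 0"
  shows "\<bar>c0 + c1*y + c2*y^2 + c3*y^3 + c4*y^4 + c5*y^5\<bar> \<le> (c0+c1+c2+c3+c4+c5) * (y+1)^5"
proof -
  have p: "y^i \<le> (y+1)^5" if "i \<le> 5" for i
  proof -
    have "y^i \<le> (y+1)^i" using assms by (intro power_mono) auto
    also have "\<dots> \<le> (y+1)^5" using assms that by (intro power_increasing) auto
    finally show ?thesis .
  qed
  have "c0*y^0 + c1*y^1 + c2*y^2 + c3*y^3 + c4*y^4 + c5*y^5
     \<le> c0*(y+1)^5 + c1*(y+1)^5 + c2*(y+1)^5 + c3*(y+1)^5 + c4*(y+1)^5 + c5*(y+1)^5"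
    using assms by (intro add_mono mult_left_mono p) auto
  thus ?thesis using assms by (simp add: algebra_simps)
qed

text \<open>
  All three certificates have numerators of degree \<open>5\<close> in \<open>k\<close>, and against them stand the denominator
  and the factor \<open>1 / (k+1)\<^sup>3\<close> from the kernel. This leaves a decay of order \<open>1/k\<close>, enough to
  absorb a sublinear weight.
\<close>

lemma rational_le:
  fixes x y c q D :: real
  assumes q: "\<bar>q\<bar> \<le> c * (y+1)^5" and D: "D \<ge> (y+1)^3" and y: "y \<ge> 0" and s: "\<bar>s\<bar> \<le> 1 / (y+1)^3"
  shows "\<bar>s * (q / D)\<bar> \<le> c / (y+1)"
proof -
  have D0: "D > 0" using y by (intro less_le_trans[OF _ D]) auto
  have c: "c * (y+1)^5 \<ge> 0" using q by linarith
  have "\<bar>s * (q / D)\<bar> = \<bar>s\<bar> * (\<bar>q\<bar> / D)" using D0 by (simp add: abs_mult)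
  also have "\<bar>q\<bar> / D \<le> c * (y+1)^5 / (y+1)^3" using D0 D y q c by (intro frac_le) auto
  hence "\<bar>s\<bar> * (\<bar>q\<bar> / D) \<le> 1 / (y+1)^3 * (c * (y+1)^5 / (y+1)^3)" using s D0 y by (intro mult_mono) auto
  also have "\<dots> = c / (y+1)"
  proof -
    have "1 / t^3 * (c * t^5 / t^3) = c / t" if "t \<noteq> 0" for t :: real
      using that by (simp add: divide_simps eval_nat_numeral)
    thus ?thesis using y by simp
  qed
  finally show ?thesis .
qed

lemma denominator_ge:
  fixes x y :: real
  assumes "x \<ge> 0" "y \<ge> 0" "c \<ge> 1" "m \<ge> 3"
  shows "(y+1)^3 \<le> c * ((6*x+1)*(6*x+5)) * (2*x+y+2)^m"
proof -
  define D where "D = (6*x+1)*(6*x+5)"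
  have "1 * 1 \<le> D" unfolding D_def using assms by (intro mult_mono) linarith+
  hence "1 * 1 \<le> c * D" using assms by (intro mult_mono) linarith+
  moreover have "(y+1)^3 \<le> (2*x+y+2)^m"
  proof -
    have "(y+1)^3 \<le> (y+1)^m" using assms by (intro power_increasing) auto
    also have "\<dots> \<le> (2*x+y+2)^m" using assms by (intro power_mono) auto
    finally show ?thesis .
  qed
  ultimately have "1 * (y+1)^3 \<le> (c * D) * (2*x+y+2)^m" using assms by (intro mult_mono) auto
  thus ?thesis by (simp add: D_def)
qed

section \<open>Decay of the certificates\<close>

lemma cert_polys_le:
  assumes "x \<ge> 0" "y \<ge> 0"
  shows cert_poly_le: "\<bar>cert_poly x y\<bar> \<le> cert_poly x 1 * (y+1)^5" and cert_poly1_le: "\<bar>- cert_poly1 x y\<bar> \<le> cert_poly1 x 1 * (y+1)^5"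
    and cert_poly2_le: "\<bar>- cert_poly2 x y\<bar> \<le> cert_poly2 x 1 * (y+1)^5"
  unfolding cert_poly_def cert_poly1_def cert_poly2_def abs_minus_cancel power_one mult_1_right
  by (rule quintic_le; intro add_nonneg_nonneg mult_nonneg_nonneg zero_le_power assms zero_le_numeral)+

lemma \<sigma>_cert_le: "\<bar>\<sigma> n k * cert (real n) (real k)\<bar> \<le> cert_poly (real n) 1 / (real k + 1)"
  unfolding cert_def by (rule rational_le[OF cert_poly_le denominator_ge _ \<sigma>_le]) simp_all

lemma \<sigma>_cert1_le: "\<bar>\<sigma> n k * cert1 (real n) (real k)\<bar> \<le> cert_poly1 (real n) 1 / (real k + 1)"
  unfolding cert1_def by (rule rational_le[OF cert_poly1_le denominator_ge _ \<sigma>_le]) simp_all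

lemma \<sigma>_cert2_le: "\<bar>\<sigma> n k * cert2 (real n) (real k)\<bar> \<le> cert_poly2 (real n) 1 / (real k + 1)"
proof -
  have D: "((6*real n+1)*(6*real n+5)) * (6*real n+3) * (2*real n+real k+2)^3 \<ge> (real k+1)^3"
    using denominator_ge[of "real n" "real k" "6*real n+3" 3] by (simp add: mult_ac)
  show ?thesis unfolding cert2_def by (rule rational_le[OF cert_poly2_le D _ \<sigma>_le]) simp_all
qed

lemma tendsto_zero_of_le_inverse:
  assumes c: "\<And>k. \<bar>f k\<bar> \<le> c / (real k + 1)"
  shows "f \<longlonglongrightarrow> 0"
proof (rule Lim_null_comparison)
  show "(\<lambda>k. c / (real k + 1)) \<longlonglongrightarrow> 0" by real_asymp
  show "\<forall>\<^sub>F k in sequentially. norm (f k) \<le> c / (real k + 1)"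
    unfolding real_norm_def by (intro always_eventually allI c)
qed

lemma mult_tendsto_zero:
  assumes c: "\<And>k. \<bar>f k\<bar> \<le> c / (real k + 1)" and h: "(\<lambda>k. h k / (real k + 1)) \<longlonglongrightarrow> 0"
  shows "(\<lambda>k. f k * h k :: real) \<longlonglongrightarrow> 0"
proof (rule Lim_null_comparison)
  show "(\<lambda>k. c * \<bar>h k / (real k + 1)\<bar>) \<longlonglongrightarrow> 0"
    by (rule tendsto_mult_right_zero[OF tendsto_rabs_zero[OF h]])
  have "\<bar>f k * h k\<bar> \<le> c * \<bar>h k / (real k + 1)\<bar>" for k
    using mult_right_mono[OF c[of k], of "\<bar>h k\<bar>"] by (simp add: abs_mult)
  thus "\<forall>\<^sub>F k in sequentially. norm (f k * h k) \<le> c * \<bar>h k / (real k + 1)\<bar>"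
    unfolding real_norm_def by (intro always_eventually allI)
qed

lemma harm_over_linear: "(\<lambda>k. harm (k + m) / (real k + 1)) \<longlonglongrightarrow> 0"
proof (rule Lim_null_comparison)
  show "(\<lambda>k. 2 * sqrt (real k + real m) / (real k + 1)) \<longlonglongrightarrow> 0" by real_asymp
  have "\<bar>harm (k + m) / (real k + 1)\<bar> \<le> 2 * sqrt (real k + real m) / (real k + 1)" for k
    using harm_le_sqrt[of "k + m"] harm_nonneg[of "k + m", where 'a = real] by (simp add: divide_right_mono)
  thus "\<forall>\<^sub>F k in sequentially. norm (harm (k + m) / (real k + 1)) \<le> 2 * sqrt (real k + real m) / (real k + 1)"
    unfolding real_norm_def by (intro always_eventually allI)
qed

lemma hsum_over_linear: "(\<lambda>k. hsum (1/2) (k + m) / (real k + 1)) \<longlonglongrightarrow> 0"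
proof (rule Lim_null_comparison)
  show "(\<lambda>k. 2 * (harm (k + m) / (real k + 1))) \<longlonglongrightarrow> 0"
    by (rule tendsto_mult_right_zero[OF harm_over_linear])
  have "\<bar>hsum (1/2) (k + m) / (real k + 1)\<bar> \<le> 2 * (harm (k + m) / (real k + 1))" for k
    using hsum_half_le[of "k + m"] hsum_nonneg[of "1/2" "k + m"] by (simp add: divide_right_mono)
  thus "\<forall>\<^sub>F k in sequentially. norm (hsum (1/2) (k + m) / (real k + 1)) \<le> 2 * (harm (k + m) / (real k + 1))"
    unfolding real_norm_def by (intro always_eventually allI)
qed

lemma const_over_linear: "(\<lambda>k. c / (real k + 1)) \<longlonglongrightarrow> (0::real)" by real_asymp

section \<open>Harmonic weights\<close>

lemma harm_le_self: "harm m \<le> real m"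
proof (induction m)
  case (Suc m)
  have "inverse (real (Suc m)) \<le> 1" by (simp add: field_simps)
  thus ?case using Suc by (simp add: harm_Suc)
qed (simp add: harm_def)

lemma hsum_half_le_self: "hsum (1/2) m \<le> 2 * real m"
  using hsum_half_le[of m] harm_le_self[of m] by linarith

text \<open>
  The logarithmic derivatives, at \<open>\<epsilon> = 0\<close>, of the gamma factors of \<open>F\<^sub>\<epsilon>\<close> in the directions
  \<open>(5/24, -1/3, 5/8)\<close> and \<open>(0, 0, 1)\<close> of \<open>(n,k,\<epsilon>)\<close>, without additive constants.
\<close>

definition weight1 :: "nat \<Rightarrow> nat \<Rightarrow> real" where
  "weight1 n k = 5/4 * (harm (2*n) + hsum (1/2) (n+k+1) - hsum (1/2) n) - 1/4 * harm (2*n+k+1) - harm k"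
definition weight2 :: "nat \<Rightarrow> nat \<Rightarrow> real" where
  "weight2 n k = 2 * hsum (1/2) (n+k+1) - 3 * hsum (1/2) n + hsum (1/2) (3*n)"

lemma weight1_Suc_n: "weight1 (Suc n) k = weight1 n k + step1n (real n) (real k)"
proof -
  have e: "2 * Suc n = Suc (Suc (2*n))" "Suc n + k + 1 = Suc (n+k+1)" "2 * Suc n + k + 1 = Suc (Suc (2*n+k+1))" by auto
  have "1 / (real (n+k+1) + 1/2) = 2 / (2*real n+2*real k+3)" "1 / (real n + 1/2) = 2 / (2*real n+1)"
    by (simp_all add: divide_simps)
  thus ?thesis unfolding weight1_def step1n_def e(1,2) unfolding e(3)[unfolded e(1)] hsum_Suc harm_Suc inverse_eq_divide
    by (simp add: algebra_simps add_divide_distrib)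
qed

lemma weight1_Suc_k: "weight1 n (Suc k) = weight1 n k + step1k (real n) (real k)"
proof -
  have e: "n + Suc k + 1 = Suc (n+k+1)" "2*n + Suc k + 1 = Suc (2*n+k+1)" by auto
  have "1 / (real (n+k+1) + 1/2) = 2 / (2*real n+2*real k+3)"
    by (simp_all add: divide_simps)
  thus ?thesis unfolding weight1_def step1k_def e hsum_Suc harm_Suc inverse_eq_divide
    by (simp add: algebra_simps)
qed

lemma weight2_Suc_n: "weight2 (Suc n) k = weight2 n k + (4/(2*real n+2*real k+3) - 6/(2*real n+1) + step2 (real n))"
proof -
  have e: "3 * Suc n = Suc (Suc (Suc (3*n)))" "Suc n + k + 1 = Suc (n+k+1)" by auto
  have "1 / (real (n+k+1) + 1/2) = 2 / (2*real n+2*real k+3)" "1 / (real n + 1/2) = 2 / (2*real n+1)"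
    "1 / (real (3*n) + 1/2) = 2 / (6*real n+1)" "1 / (real (Suc (3*n)) + 1/2) = 2 / (6*real n+3)"
    "1 / (real (Suc (Suc (3*n))) + 1/2) = 2 / (6*real n+5)"
    by (simp_all add: divide_simps)
  thus ?thesis unfolding weight2_def step2_def e hsum_Suc by simp
qed

lemma weight2_Suc_k: "weight2 n (Suc k) = weight2 n k + 4/(2*real n+2*real k+3)"
proof -
  have e: "n + Suc k + 1 = Suc (n+k+1)" by auto
  have "1 / (real (n+k+1) + 1/2) = 2 / (2*real n+2*real k+3)"
    by (simp_all add: divide_simps)
  thus ?thesis unfolding weight2_def e hsum_Suc by simp
qed

lemma weight_bounds: "\<bar>weight1 n k\<bar> \<le> 20 * (real n + real k + 1)" "\<bar>weight2 n k\<bar> \<le> 20 * (real n + real k + 1)"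
proof -
  note le = harm_le_self[of "2*n"] harm_le_self[of "2*n+k+1"] harm_le_self[of k] hsum_half_le_self[of "n+k+1"]
    hsum_half_le_self[of n] hsum_half_le_self[of "3*n"]
  note ge = harm_nonneg[of "2*n", where 'a = real] harm_nonneg[of "2*n+k+1", where 'a = real] harm_nonneg[of k, where 'a = real]
    hsum_nonneg[of "1/2" "n+k+1"] hsum_nonneg[of "1/2" n] hsum_nonneg[of "1/2" "3*n"]
  show "\<bar>weight1 n k\<bar> \<le> 20 * (real n + real k + 1)" unfolding weight1_def using le ge unfolding abs_le_iff
    by (simp add: algebra_simps)
  show "\<bar>weight2 n k\<bar> \<le> 20 * (real n + real k + 1)" unfolding weight2_def using le ge unfolding abs_le_iff
    by (simp add: algebra_simps)
qed

lemma weight1_over_linear: "(\<lambda>k. weight1 n k / (real k + 1)) \<longlonglongrightarrow> 0"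
proof -
  have e: "weight1 n k / (real k + 1) = 5/4 * (hsum (1/2) (k+(n+1)) / (real k + 1)) + 5/4 * (harm (2*n) - hsum (1/2) n) / (real k + 1)
    + (- 1/4) * (harm (k+(2*n+1)) / (real k + 1)) + (- 1) * (harm (k+0) / (real k + 1))" for k
    unfolding weight1_def by (simp add: add_divide_distrib diff_divide_distrib algebra_simps)
  show ?thesis unfolding e
    by (intro tendsto_add_zero tendsto_mult_right_zero hsum_over_linear harm_over_linear const_over_linear)
qed

lemma weight2_over_linear: "(\<lambda>k. (weight2 n k + c) / (real k + 1)) \<longlonglongrightarrow> 0"
proof -
  have e: "(weight2 n k + c) / (real k + 1)
      = 2 * (hsum (1/2) (k+(n+1)) / (real k + 1)) + (hsum (1/2) (3*n) - 3 * hsum (1/2) n + c) / (real k + 1)" for k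
    unfolding weight2_def by (simp add: add_divide_distrib diff_divide_distrib algebra_simps)
  show ?thesis unfolding e
    by (intro tendsto_add_zero tendsto_mult_right_zero hsum_over_linear const_over_linear)
qed

text \<open>
  The kernel at \<open>n+1\<close> is at most of order \<open>3\<^sup>-\<^sup>n (k+1)\<^sup>-\<^sup>4\<close>, while \<open>n+k+1\<close> times the weight grows at most
  quadratically. This is a summable function of \<open>k\<close> times a null sequence in \<open>n\<close>.
\<close>

lemma F_bound:
  assumes "\<bar>h\<bar> \<le> 20 * (real (Suc n) + real k + 1)" "\<bar>c\<bar> \<le> 1"
  shows "\<bar>\<sigma> (Suc n) k * ((real (Suc n) + real k + 1) * h + c)\<bar> \<le> (168 * (real n + 2)^2 * (1/3)^n) * (1 / (real k + 1)^2)"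
proof -
  define s where "s = real (Suc n) + real k + 1"
  have s: "1 \<le> s" "s \<le> (real n + 2) * (real k + 1)" by (auto simp: s_def algebra_simps)
  have "\<bar>s * h + c\<bar> \<le> \<bar>s * h\<bar> + \<bar>c\<bar>" by (rule abs_triangle_ineq)
  also have "\<bar>s * h\<bar> = s * \<bar>h\<bar>" using s by (simp add: abs_mult)
  also have "s * \<bar>h\<bar> + \<bar>c\<bar> \<le> s * (20 * s) + s * s"
  proof (rule add_mono)
    show "s * \<bar>h\<bar> \<le> s * (20 * s)" using assms(1) s unfolding s_def[symmetric] by (intro mult_left_mono) simp_all
    have "1 * 1 \<le> s * s" using s by (intro mult_mono) simp_all
    thus "\<bar>c\<bar> \<le> s * s" using assms(2) by simp
  qed
  also have "\<dots> = 21 * s^2" by (simp add: power2_eq_square)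
  also have "\<dots> \<le> 21 * ((real n + 2) * (real k + 1))^2" using s by (intro mult_left_mono power_mono) simp_all
  finally have "\<bar>\<sigma> (Suc n) k\<bar> * \<bar>s * h + c\<bar> \<le> ((1/3)^n * (8 / (real k + 1)^4)) * (21 * ((real n + 2) * (real k + 1))^2)"
    by (rule mult_mono[OF \<sigma>_Suc_le]) simp_all
  also have "\<dots> = (168 * (real n + 2)^2 * (1/3)^n) * (1 / (real k + 1)^2)"
  proof -
    have "e * (8 / t^4) * (21 * (m * t)^2) = (168 * m^2 * e) * (1 / t^2)" if "t \<noteq> 0" for e t m :: real
      using that by (simp add: power_mult_distrib power2_eq_square power4_eq_xxxx)
    thus ?thesis by simp
  qed
  finally show ?thesis by (simp only: abs_mult s_def)
qed

lemma decay: "(\<lambda>n. 168 * (real n + 2)^2 * (1/3)^n) \<longlonglongrightarrow> 0" by real_asymp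

lemma summable_b: "summable (\<lambda>k. 1 / (real k + 1)^2)"
  using summable_Suc_iff[THEN iffD2, OF inverse_power_summable[of 2, where 'a = real]]
  by (simp add: inverse_eq_divide add_ac)

section \<open>The two weighted pairs and their sums\<close>

text \<open>
  Each pair is the directional derivative of the unweighted pair, written as the kernel times
  (weight times rational function plus correction).
\<close>

definition G1 :: "nat \<Rightarrow> nat \<Rightarrow> real" where
  "G1 n k = \<sigma> n k * (cert (real n) (real k) * weight1 n k + cert1 (real n) (real k))"
definition F1 :: "nat \<Rightarrow> nat \<Rightarrow> real" where
  "F1 n k = \<sigma> n k * ((real n + real k + 1) * weight1 n k + (- 1/8))"
definition G2 :: "nat \<Rightarrow> nat \<Rightarrow> real" where
  "G2 n k = \<sigma> n k * (cert (real n) (real k) * (weight2 n k + step2 (real n)) + cert2 (real n) (real k))"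
definition F2 :: "nat \<Rightarrow> nat \<Rightarrow> real" where
  "F2 n k = \<sigma> n k * ((real n + real k + 1) * weight2 n k + 0)"

lemma wz1: "F1 (Suc n) k - F1 n k = G1 n (Suc k) - G1 n k"
proof -
  define x y where "x = real n" and "y = real k"
  have S: "real (Suc n) = x + 1" "real (Suc k) = y + 1" by (auto simp: x_def y_def)
  have xy: "x \<ge> 0" "y \<ge> 0" by (auto simp: x_def y_def)
  show ?thesis
    unfolding F1_def G1_def \<sigma>_Suc_n \<sigma>_Suc_k weight1_Suc_n weight1_Suc_k S x_def[symmetric] y_def[symmetric]
    using cert_identity[OF xy] cert1_identity[OF xy] by algebra
qed

lemma wz2: "F2 (Suc n) k - F2 n k = G2 n (Suc k) - G2 n k"
proof -
  define x y where "x = real n" and "y = real k"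
  have S: "real (Suc n) = x + 1" "real (Suc k) = y + 1" by (auto simp: x_def y_def)
  have xy: "x \<ge> 0" "y \<ge> 0" by (auto simp: x_def y_def)
  show ?thesis
    unfolding F2_def G2_def \<sigma>_Suc_n \<sigma>_Suc_k weight2_Suc_n weight2_Suc_k S x_def[symmetric] y_def[symmetric]
    using cert_identity[OF xy] cert2_identity[OF xy] by algebra
qed

lemma \<sigma>_0: "\<sigma> 0 k = 1 / (real k + 1)^3"
  by (simp add: \<sigma>_def alt_coeff_def beta_0 power_divide)

text \<open>
  At \<open>n = 0\<close> the kernel is \<open>1 / (k+1)\<^sup>3\<close>, so the weights turn into the numerators of Euler sums.
\<close>

lemma F1_0_sums: "F1 0 sums (11/4 * zeta 3)"
proof -
  have F: "F1 0 k = 5/4 * (hsum (1/2) (Suc k) / (real k + 1)^2) - 5/4 * (harm (Suc k) / (real k + 1)^2) + 7/8 * (1 / (real k + 1)^3)" for k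
  proof -
    have h: "weight1 0 k = 5/4 * (hsum (1/2) (Suc k) - harm (Suc k)) + 1 / (real k + 1)"
      by (simp add: weight1_def harm_Suc[of k] hsum_def[of _ 0] harm_def[of 0] inverse_eq_divide algebra_simps) (simp add: divide_simps)
    have "1 / t^3 * (t * (5/4 * (a - b) + 1/t) + (- 1/8)) = 5/4 * (a / t^2) - 5/4 * (b / t^2) + 7/8 * (1 / t^3)"
      if "t \<noteq> 0" for a b t :: real
      using that by (simp add: field_simps power2_eq_square power3_eq_cube)
    from this[of "real k + 1"] show ?thesis unfolding F1_def \<sigma>_0 h by simp
  qed
  have "(\<lambda>k. 5/4 * (hsum (1/2) (Suc k) / (real k + 1)^2) - 5/4 * (harm (Suc k) / (real k + 1)^2) + 7/8 * (1 / (real k + 1)^3))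
     sums (5/4 * (7/2 * zeta 3) - 5/4 * (2 * zeta 3) + 7/8 * zeta 3)"
    by (intro sums_add sums_diff sums_mult sum_hsum_half_over_squares sum_harm_over_squares zeta3_sums)
  also have "5/4 * (7/2 * zeta 3) - 5/4 * (2 * zeta 3) + 7/8 * zeta 3 = (11/4 * zeta 3 :: real)" by simp
  finally show ?thesis unfolding F[symmetric] .
qed

lemma F2_0_sums: "F2 0 sums (7 * zeta 3)"
proof -
  have F: "F2 0 k = 2 * (hsum (1/2) (Suc k) / (real k + 1)^2)" for k
  proof -
    have h: "weight2 0 k = 2 * hsum (1/2) (Suc k)" by (simp add: weight2_def hsum_def[of _ 0])
    have "1 / t^3 * (t * (2 * a) + 0) = 2 * (a / t^2)" if "t \<noteq> 0" for a t :: real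
      using that by (simp add: field_simps power2_eq_square power3_eq_cube)
    from this[of "real k + 1"] show ?thesis unfolding F2_def \<sigma>_0 h by simp
  qed
  have "(\<lambda>k. 2 * (hsum (1/2) (Suc k) / (real k + 1)^2)) sums (2 * (7/2 * zeta 3))"
    by (intro sums_mult sum_hsum_half_over_squares)
  thus ?thesis unfolding F[symmetric] by simp
qed

lemma G1_tendsto: "G1 n \<longlonglongrightarrow> 0"
proof -
  have "G1 n = (\<lambda>k. \<sigma> n k * cert (real n) (real k) * weight1 n k + \<sigma> n k * cert1 (real n) (real k))"
    by (simp only: fun_eq_iff G1_def distrib_left mult.assoc simp_thms)
  thus ?thesis
    using tendsto_add[OF mult_tendsto_zero[OF \<sigma>_cert_le weight1_over_linear] tendsto_zero_of_le_inverse[OF \<sigma>_cert1_le]] by simp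
qed

lemma G2_tendsto: "G2 n \<longlonglongrightarrow> 0"
proof -
  have "G2 n = (\<lambda>k. \<sigma> n k * cert (real n) (real k) * (weight2 n k + step2 (real n)) + \<sigma> n k * cert2 (real n) (real k))"
    by (simp only: fun_eq_iff G2_def distrib_left mult.assoc simp_thms)
  thus ?thesis
    using tendsto_add[OF mult_tendsto_zero[OF \<sigma>_cert_le weight2_over_linear] tendsto_zero_of_le_inverse[OF \<sigma>_cert2_le]] by simp
qed

lemma G1_sums: "(\<lambda>n. G1 n 0) sums (11/4 * zeta 3)"
  by (rule wz_sums[OF wz1 G1_tendsto _ summable_b decay F1_0_sums]) (unfold F1_def, rule F_bound[OF weight_bounds(1)], simp)

lemma G2_sums: "(\<lambda>n. G2 n 0) sums (7 * zeta 3)"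
  by (rule wz_sums[OF wz2 G2_tendsto _ summable_b decay F2_0_sums]) (unfold F2_def, rule F_bound[OF weight_bounds(2)], simp)

section \<open>Identification of the summands\<close>

lemma alt_coeff_binomial: "alt_coeff n = (-1)^n * real ((2*n) choose n)^2 / (real ((3*n) choose n) * real ((6*n) choose (3*n)))"
proof -
  have b: "real ((m + l) choose l) = fact (m + l) / (fact l * fact m)" for m l
    by (simp add: binomial_fact)
  have e: "n + n = 2*n" "2*n + n = 3*n" "3*n + 3*n = 6*n" by auto
  have "s * z^3 * u / (a^3 * v) = s * (z / (a * a))^2 / (u / (a * z) * (v / (u * u)))"
    if "z \<noteq> 0" "u \<noteq> 0" "a \<noteq> 0" "v \<noteq> 0" for s z u a v :: real
    using that by (simp add: field_simps power2_eq_square power3_eq_cube)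
  thus ?thesis
    unfolding alt_coeff_def b[of n n, unfolded e] b[of "2*n" n, unfolded e] b[of "3*n" "3*n", unfolded e] by simp
qed

text \<open>
  The common part of the two summands in terms of \<open>alt_coeff n\<close>: stepping back from \<open>k = n+1\<close> to \<open>n\<close>
  cancels two of the three factors \<open>2k-1\<close>.
\<close>

lemma summand_eq:
  "(- 1) ^ (Suc n - 1) * real ((2 * Suc n) choose Suc n) ^ 2 * w
     / ((2 * real (Suc n) - 1) ^ 3 * real (Suc n) ^ 2 * real ((3 * Suc n) choose Suc n) * real ((6 * Suc n) choose (3 * Suc n)))
   = alt_coeff n / (3 * ((6*real n+1)*(6*real n+5)) * (2*real n+1) * (real n+1)^2) * w"
proof -
  have "s * c^2 * w / (p^3 * q^2 * d * e) = - (- s * c^2 / (d * e)) / (p^3 * q^2) * w" for s c p q d e :: real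
    by simp
  hence "(- 1) ^ (Suc n - 1) * real ((2 * Suc n) choose Suc n) ^ 2 * w
     / ((2 * real (Suc n) - 1) ^ 3 * real (Suc n) ^ 2 * real ((3 * Suc n) choose Suc n) * real ((6 * Suc n) choose (3 * Suc n)))
    = - (- ((- 1) ^ (Suc n - 1)) * real ((2 * Suc n) choose Suc n) ^ 2 / (real ((3 * Suc n) choose Suc n) * real ((6 * Suc n) choose (3 * Suc n))))
       / ((2 * real (Suc n) - 1) ^ 3 * real (Suc n) ^ 2) * w" .
  also have "- ((- 1) ^ (Suc n - 1)) = (-1 :: real) ^ Suc n" by simp
  also have "- ((-1) ^ Suc n * real ((2 * Suc n) choose Suc n) ^ 2 / (real ((3 * Suc n) choose Suc n) * real ((6 * Suc n) choose (3 * Suc n))))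
     = (2*real n+1)^2 / (3 * ((6*real n+1)*(6*real n+5))) * alt_coeff n"
    unfolding alt_coeff_binomial[symmetric] alt_coeff_Suc by simp
  finally have *: "(- 1) ^ (Suc n - 1) * real ((2 * Suc n) choose Suc n) ^ 2 * w
     / ((2 * real (Suc n) - 1) ^ 3 * real (Suc n) ^ 2 * real ((3 * Suc n) choose Suc n) * real ((6 * Suc n) choose (3 * Suc n)))
    = (2*real n+1)^2 / (3 * ((6*real n+1)*(6*real n+5))) * alt_coeff n / ((2 * real (Suc n) - 1) ^ 3 * real (Suc n) ^ 2) * w" .
  have s: "2 * real (Suc n) - 1 = 2 * real n + 1" "real (Suc n) = real n + 1" by simp_all
  have gen: "p^2 / (3*D) * a / (p^3 * q^2) * w = a / (3 * D * p * q^2) * w" if "p \<noteq> 0" for p q D a :: real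
    using that by (simp add: power2_eq_square power3_eq_cube)
  show ?thesis unfolding * unfolding s(1) unfolding s(2) by (rule gen) (use of_nat_0_le_iff[of n, where 'a = real] in linarith)
qed

text \<open>
  At \<open>k = 0\<close> the certificate numerator factors, and the polynomial \<open>P\<close> of the theorem appears. The
  corrections carry \<open>P\<close> as well, because the weights at \<open>k = 0\<close> differ from the harmonic numbers of
  the theorem by multiples of \<open>1 / (2n+1)\<close>; the remaining products give the rational terms of the
  summands.
\<close>

lemma cert_poly_at_0: "cert_poly x 0 = 4 * P (x+1) * (2*x+1)^2 * (x+1)"
  unfolding cert_poly_def P_def by (simp, algebra)

lemma cert_poly1_at_0: "cert_poly1 x 0 = 40 * P (x+1) * (2*x+1) * (x+1)^2 - 640 * (6*x+5) * (2*x+1) * (x+1)^4"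
  unfolding cert_poly1_def P_def by (simp, algebra)

lemma cert_poly2_at_0: "cert_poly2 x 0 = 12 * P (x+1) * (2*x+1)^2 * (x+1) - 32 * (28*x+25) * (2*x+1)^2 * (x+1)^3"
  unfolding cert_poly2_def P_def by (simp, algebra)

lemma \<sigma>_n_0: "\<sigma> n 0 = alt_coeff n / (2*real n+1)^3"
  by (simp add: \<sigma>_def beta_def power_divide add_ac)

lemma term1_eq: "term1 (Suc n) = 4 * G1 n 0"
proof -
  define x where "x = real n"
  have x: "x \<ge> 0" by (simp add: x_def)
  define D p q where "D = (6*x+1)*(6*x+5)" and "p = 2*x+1" and "q = x+1"
  have pos: "D \<noteq> 0" "p \<noteq> 0" "q \<noteq> 0" using x by (auto simp: D_def p_def q_def)
  define H where "H = (harm (2*n+1) :: real)"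
  have q2: "2*x+0+2 = 2*q" by (simp add: q_def)
  have e: "6 * (x+1) - 1 = 6*x+5" "2 * (x+1) - 1 = p" by (simp_all add: p_def)
  have h: "weight1 n 0 = H + 5/4 * (1/p)"
  proof -
    have "1 / (real n + 1/2) = 2 / p" by (simp add: p_def x_def divide_simps)
    moreover have "H = harm (2*n) + 1/p" by (simp add: H_def harm_Suc inverse_eq_divide p_def x_def add_ac)
    ultimately show ?thesis unfolding weight1_def add_0_right H_def[symmetric]
      by (simp add: hsum_Suc harm_def[of 0] add_divide_distrib)
  qed
  have alg: "4 * (a / p^3 * ((4 * c * p^2 * q) / (6 * D * (2*q)^3) * (H + 5/4 * (1/p))
      + - (40 * c * p * q^2 - 640 * e * p * q^4) / (24 * D * (2*q)^4)))
    = a / (3 * D * p * q^2) * (c * H + 20 * q^2 * e / p)" for a c e :: real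
    using pos by (simp add: divide_simps) algebra
  have "term1 (Suc n) = alt_coeff n / (3 * D * p * q^2) * (P q * H + 20 * q^2 * (6*x+5) / p)"
    unfolding term1_def summand_eq D_def p_def q_def H_def x_def by (simp add: add_ac)
  also have "\<dots> = 4 * G1 n 0"
    unfolding alg[symmetric] G1_def h \<sigma>_n_0 cert_def cert1_def of_nat_0 x_def[symmetric] q2 cert_poly_at_0 cert_poly1_at_0 cert_poly2_at_0
    unfolding D_def[symmetric] p_def[symmetric] q_def[symmetric] by (rule refl)
  finally show ?thesis .
qed

lemma term2_eq: "term2 (Suc n) = 2 * term1 (Suc n) + 4 * G2 n 0"
proof -
  define x where "x = real n"
  have x: "x \<ge> 0" by (simp add: x_def)
  define D p q where "D = (6*x+1)*(6*x+5)" and "p = 2*x+1" and "q = x+1"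
  have pos: "D \<noteq> 0" "p \<noteq> 0" "q \<noteq> 0" using x by (auto simp: D_def p_def q_def)
  define H where "H = (harm (2*n+1) :: real)"
  define K where "K = (2 * harm (6 * Suc n - 1) - harm (3 * Suc n - 1) + harm n :: real)"
  have q2: "2*x+0+2 = 2*q" and p3: "6*x+3 = 3*p" by (simp_all add: p_def q_def)
  \<comment> \<open>the weight of \<open>G\<close> is taken at \<open>O (3n+3)\<close>, which equals \<open>2 H (6k-1) - H (3k-1)\<close> for \<open>k = n+1\<close>\<close>
  have h: "weight2 n 0 + step2 x = K - 2 * H + 6 * (1/p)"
  proof -
    have a: "1 / (real n + 1/2) = 2 / p" by (simp add: p_def x_def divide_simps)
    have "weight2 (Suc n) 0 = weight2 n 0 + (4/(2*x+2*0+3) - 6/p + step2 x)"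
      unfolding weight2_Suc_n x_def p_def by simp
    moreover have "weight2 (Suc n) 0 = weight2 n 0 + (4/(2*x+2*0+3) - 6/p) + (hsum (1/2) (3 * Suc n) - hsum (1/2) (3 * n))"
    proof -
      have "1 / (real (Suc n) + 1/2) = 2 / (2*x+2*0+3)" by (simp add: x_def divide_simps)
      thus ?thesis unfolding weight2_def using a by (simp add: hsum_Suc del: mult_Suc_right)
    qed
    ultimately have t: "step2 x = hsum (1/2) (3 * Suc n) - hsum (1/2) (3 * n)" by simp
    have "6 * Suc n = Suc (6 * Suc n - 1)" "3 * Suc n = Suc (3 * Suc n - 1)" by simp_all
    hence "harm (6 * Suc n) = harm (6 * Suc n - 1) + 1 / (6 * q)" "harm (3 * Suc n) = harm (3 * Suc n - 1) + 1 / (3 * q)"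
      by (metis harm_Suc inverse_eq_divide of_nat_mult of_nat_numeral of_nat_Suc add.commute q_def x_def)+
    hence k: "hsum (1/2) (3 * Suc n) + harm n = K"
      unfolding hsum_half K_def by (simp add: mult.assoc[symmetric] del: mult_Suc_right)
    have "H = harm (2*n) + 1/p" by (simp add: H_def harm_Suc inverse_eq_divide p_def x_def add_ac)
    hence "hsum (1/2) n = 2 * (H - 1/p) - harm n" by (simp add: hsum_half)
    thus ?thesis unfolding t k[symmetric] weight2_def using a by (simp add: hsum_Suc)
  qed
  have alg: "4 * (a / p^3 * ((4 * c * p^2 * q) / (6 * D * (2*q)^3) * (K - 2 * H + 6 * (1/p))
      + - (12 * c * p^2 * q - 32 * e * p^2 * q^3) / (D * (3*p) * (2*q)^3)))
    = a / (3 * D * p * q^2) * (c * (K - 2 * H) + 16 * q^2 * e / p)" for a c e :: real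
    using pos by (simp add: divide_simps) algebra
  have val1: "term1 (Suc n) = alt_coeff n / (3 * D * p * q^2) * (P q * H + 20 * q^2 * (6*x+5) / p)"
    unfolding term1_def summand_eq D_def p_def q_def H_def x_def by (simp add: add_ac)
  have val2: "term2 (Suc n) = alt_coeff n / (3 * D * p * q^2) * (P q * K + 8 * q^2 * ((86*x+75) / p))"
    unfolding term2_def summand_eq D_def p_def q_def K_def x_def by (simp add: add_ac)
  have "term2 (Suc n) - 2 * term1 (Suc n) = alt_coeff n / (3 * D * p * q^2) * (P q * (K - 2 * H) + 16 * q^2 * (28*x+25) / p)"
    unfolding val1 val2 using pos by (simp add: field_simps)
  also have "\<dots> = 4 * G2 n 0"
    unfolding alg[symmetric] G2_def \<sigma>_n_0 cert_def cert2_def of_nat_0 x_def[symmetric] h q2 p3 cert_poly_at_0 cert_poly1_at_0 cert_poly2_at_0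
    unfolding D_def[symmetric] p_def[symmetric] q_def[symmetric] by (rule refl)
  finally show ?thesis by simp
qed

theorem theorem1p11:
  shows "(\<lambda>n. term1 (Suc n)) sums (11 * zeta 3) \<and>
         (\<lambda>n. term2 (Suc n)) sums (50 * zeta 3)"
proof
  have "(\<lambda>n. term1 (Suc n)) sums (4 * (11/4 * zeta 3))"
    unfolding term1_eq by (intro sums_mult G1_sums)
  thus t1: "(\<lambda>n. term1 (Suc n)) sums (11 * zeta 3)" by simp
  have "(\<lambda>n. term2 (Suc n)) sums (2 * (11 * zeta 3) + 4 * (7 * zeta 3))"
    unfolding term2_eq by (intro sums_add sums_mult t1 G2_sums)
  thus "(\<lambda>n. term2 (Suc n)) sums (50 * zeta 3)" by simp
qed

end
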